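(* Let $\lambda>0$ be rational and suppose that, for every positive integer $n$, the maximizing $n$-term denominator tuple for $R_n^{\leq}(\lambda)$ is unique. Let $(b_n)_{n\geq 1}$ be the eventually greedy best sequence for $\lambda$ described in the context, and let $(a_n)_{n\geq 1}$ be a sequence of integers satisfying \[ 2\leq a_1\leq a_2\leq a_3\leq\cdots,\qquad \sum_{n=1}^{\infty}\frac1{a_n}=\lambda . \] If $(a_n)_{n\geq 1}\neq(b_n)_{n\geq 1}$, then \[ \liminf_{n\to\infty}a_n^{2^{-n}}<\lim_{n\to\infty}b_n^{2^{-n}} . \]
   Context: $\mathbb{N}=\{1,2,\ldots\}$. For $n\geq 1$ let $\mathcal{E}_n^{\leq}=\{(a_1,\ldots,a_n)\in\mathbb{N}^n: 2\leq a_1\leq\cdots\leq a_n\}$, and for real $\lambda>0$ let \[ R_n^{\leq}(\lambda)=\max\Bigl\{\sum_{i=1}^n\frac1{a_i}:\ (a_1,\ldots,a_n)\in\mathcal{E}_n^{\leq},\ \sum_{i=1}^n\frac1{a_i}<\lambda\Bigr\} \] (the maximum is known to exist). A tuple in $\mathcal{E}_n^{\leq}$ attaining this maximum is called a maximizing $n$-term denominator tuple. The sequence $(b_n)$: for every positive rational $\lambda$ the paper constructs an integer $N\geq 1$, a maximizing tuple $(b_1,\ldots,b_N)$ for $R_N^{\leq}(\lambda)$, and an integer $T_0\geq 2$ such that $\lambda=\sum_{i=1}^N 1/b_i+1/T_0$ and such that the following holds. Define $T_{j+1}=T_j(T_j+1)$ for $j\geq 0$ and extend $b_1,\ldots,b_N$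 to an infinite sequence by $b_{N+j+1}=T_j+1$ for $j\geq 0$; then $\sum_{n=1}^\infty 1/b_n=\lambda$ and $\sum_{i=1}^n 1/b_i=R_n^{\leq}(\lambda)$ for every $n\geq N$. The sequence $(b_n)_{n\geq 1}$ so obtained is the eventually greedy best sequence for $\lambda$. The limit $\lim_{n\to\infty}b_n^{2^{-n}}$ exists and is finite and strictly positive. *)

theory Defs
  imports Complex_Main "HOL-Library.Extended_Real"
begin

definition denom_tuples :: "nat \<Rightarrow> nat list set" where
  "denom_tuples n = {xs. length xs = n \<and> sorted xs \<and> (\<forall>x\<in>set xs. 2 \<le> x)}"

definition unit_fraction_sum :: "nat list \<Rightarrow> real" where
  "unit_fraction_sum xs = (\<Sum>x\<leftarrow>xs. 1 / real x)"

definition max_underapprox :: "nat \<Rightarrow> real \<Rightarrow> real" where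
  "max_underapprox n lam =
     (GREATEST s. \<exists>xs\<in>denom_tuples n. s = unit_fraction_sum xs \<and> unit_fraction_sum xs < lam)"

definition maximizing_tuple :: "nat \<Rightarrow> real \<Rightarrow> nat list \<Rightarrow> bool" where
  "maximizing_tuple n lam =
     is_arg_max unit_fraction_sum (\<lambda>xs. xs \<in> denom_tuples n \<and> unit_fraction_sum xs < lam)"

lemma max_underapprox_eq:
  assumes "maximizing_tuple n lam xs"
  shows "max_underapprox n lam = unit_fraction_sum xs"
  unfolding max_underapprox_def
  by (rule Greatest_equality)
     (use assms in \<open>auto simp: maximizing_tuple_def is_arg_max_linorder\<close>)

primrec greedy_T :: "nat \<Rightarrow> nat \<Rightarrow> nat" where
  "greedy_T T0 0 = T0"
| "greedy_T T0 (Suc j) = greedy_T T0 j * (greedy_T T0 j + 1)"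

text \<open>Sequences are indexed from 1; the value at index 0 is never used. The predicate need not
  determine \<open>b\<close> in general, but it does so (on positive indices) whenever all maximizing tuples
  for \<open>lam\<close> are unique, since all sufficiently long initial segments of \<open>b\<close> are maximizing.\<close>

definition eventually_greedy_best :: "real \<Rightarrow> (nat \<Rightarrow> nat) \<Rightarrow> bool" where
  "eventually_greedy_best lam b \<longleftrightarrow>
     (\<exists>N T0. 1 \<le> N \<and> 2 \<le> T0 \<and>
        maximizing_tuple N lam (map b [1..<Suc N]) \<and>
        lam = (\<Sum>i=1..N. 1 / real (b i)) + 1 / real T0 \<and>
        (\<forall>j. b (N + j + 1) = greedy_T T0 j + 1) \<and>
        (\<lambda>n. 1 / real (b (Suc n))) sums lam \<and>
        (\<forall>n\<ge>N. (\<Sum>i=1..n. 1 / real (b i)) = max_underapprox n lam))"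

text \<open>The limit of \<open>b\<^sub>n\<close> to the power \<open>2\<^sup>-\<^sup>n\<close> exists and is positive, so \<^const>\<open>lim\<close> applied to it
  is meaningful.\<close>

lemma powr_half_power_Suc:
  assumes "(x::real) \<ge> 0"
  shows "(x\<^sup>2) powr (1 / 2 ^ Suc n) = x powr (1 / 2 ^ n)"
proof (cases "x = 0")
  case False
  then have "x\<^sup>2 = x powr 2" using assms by simp
  then show ?thesis by (simp add: powr_powr)
qed simp

lemma greedy_T_ge: "2 \<le> T0 \<Longrightarrow> 2 \<le> greedy_T T0 j"
  by (induction j) (auto intro: order_trans[OF _ mult_le_mono[of 1 _ 2]])

lemma eventually_greedy_best_convergent:
  assumes "eventually_greedy_best lam b"
  shows "\<exists>L>0. (\<lambda>n. real (b n) powr (1 / 2 ^ n)) \<longlonglongrightarrow> L"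
proof -
  obtain N T0 where T0: "2 \<le> T0" and b: "\<And>j. b (N + j + 1) = greedy_T T0 j + 1"
    using assms unfolding eventually_greedy_best_def by blast
  define T where "T = greedy_T T0"
  define e where "e j = 1 / (2::real) ^ (j + (N + 1))" for j
  define u where "u j = real (T j + 1) powr e j" for j
  define l where "l j = real (T j) powr e j" for j
  have TS: "T (Suc j) = T j * (T j + 1)" for j by (simp add: T_def)
  have pos: "real (T j) > 0" for j using greedy_T_ge[OF T0, of j] by (simp add: T_def)
  have "u (Suc j) \<le> u j" for j
  proof -
    have "u (Suc j) \<le> ((real (T j + 1))\<^sup>2) powr e (Suc j)"
      unfolding u_def by (rule powr_mono2) (auto simp: TS power2_eq_square e_def algebra_simps)
    also have "\<dots> = u j"
      unfolding u_def e_def by (simp add: powr_half_power_Suc del: power_Suc of_nat_add)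
    finally show ?thesis .
  qed
  then have dec: "decseq u" by (rule decseq_SucI)
  have "l j \<le> l (Suc j)" for j
  proof -
    have "l j = ((real (T j))\<^sup>2) powr e (Suc j)"
      unfolding l_def e_def by (simp add: powr_half_power_Suc del: power_Suc)
    also have "\<dots> \<le> l (Suc j)"
      unfolding l_def by (rule powr_mono2) (auto simp: TS power2_eq_square e_def algebra_simps)
    finally show ?thesis .
  qed
  then have "incseq l" by (rule incseq_SucI)
  then have "l 0 \<le> l j" for j by (simp add: incseqD)
  moreover have "l j \<le> u j" for j
    unfolding l_def u_def by (rule powr_mono2) (auto simp: e_def)
  ultimately have lb: "l 0 \<le> u j" for j using order_trans by blast
  obtain L where L: "u \<longlonglongrightarrow> L" using decseq_convergent[OF dec] lb by metis
  have "l 0 \<le> L" using LIMSEQ_le_const[OF L] lb by blast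
  moreover have "l 0 > 0" using pos[of 0] by (simp add: l_def)
  moreover have "(\<lambda>n. real (b n) powr (1 / 2 ^ n)) \<longlonglongrightarrow> L"
  proof (rule LIMSEQ_offset)
    have "real (b (j + (N + 1))) powr (1 / 2 ^ (j + (N + 1))) = u j" for j
      using b[of j] by (simp add: u_def e_def T_def add_ac)
    then show "(\<lambda>j. real (b (j + (N + 1))) powr (1 / 2 ^ (j + (N + 1)))) \<longlonglongrightarrow> L"
      using L by simp
  qed
  ultimately show ?thesis by (intro exI[of _ L]) auto
qed

end

theory Submission
  imports Defs "HOL-Library.Multiset"
begin

text \<open>Uniqueness of the maximizing tuples makes the residual \<open>r n = lam - (\<Sum>i=1..n. 1 / a i)\<close> strictly
  larger than that of \<open>b\<close>, which is \<open>1 / y n\<close> with \<open>y (n+1) = y n (y n + 1)\<close>. Suppose the liminf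
  were at least the limit \<open>L\<close>; then \<open>1 / r n\<close> eventually exceeds \<open>K\<^bsup>2^(n+1)\<^esup> / 2\<close> for every \<open>K < L\<close>.
  Write \<open>r n = p n / q n\<close> with \<open>q n\<close> a fixed multiple of \<open>a 1 \<cdots> a n\<close>, so that the \<open>p n\<close> are positive
  integers, and choose \<open>m\<close> with \<open>p m\<close> minimal among all later \<open>p k\<close>. The quantity
  \<open>x k = q k / sqrt (p m * p k) \<ge> 1 / r k\<close> then satisfies \<open>x (k+1) \<le> x k (x k + 1)\<close> and starts
  strictly below \<open>y m\<close>, so its growth rate is strictly smaller than \<open>L\<close>, a contradiction.\<close>

section \<open>Doubly exponential growth and comparison of recursions\<close>

lemma less_powr_half_power_iff:
  fixes x K :: real
  assumes "K \<ge> 0" "x > 0"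
  shows "K < x powr (1 / 2 ^ n) \<longleftrightarrow> K ^ 2 ^ n < x"
    and "x powr (1 / 2 ^ n) < K \<longleftrightarrow> x < K ^ 2 ^ n"
proof -
  define y where "y = x powr (1 / 2 ^ n)"
  have y: "y > 0" using assms by (simp add: y_def)
  have "y ^ 2 ^ n = y powr (2 ^ n)"
    using powr_realpow[OF y, of "2 ^ n"] by simp
  also have "\<dots> = x" using assms by (simp add: y_def powr_powr)
  finally have x: "y ^ 2 ^ n = x" .
  have "y ^ 2 ^ n \<le> K ^ 2 ^ n \<longleftrightarrow> y \<le> K" "K ^ 2 ^ n \<le> y ^ 2 ^ n \<longleftrightarrow> K \<le> y"
    by (rule power_mono_iff; use y assms in simp)+
  then show "K < x powr (1 / 2 ^ n) \<longleftrightarrow> K ^ 2 ^ n < x"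
    and "x powr (1 / 2 ^ n) < K \<longleftrightarrow> x < K ^ 2 ^ n"
    unfolding x y_def[symmetric] by linarith+
qed

lemma eventually_less_double_power:
  fixes K C :: real
  assumes "K > 1"
  shows "eventually (\<lambda>n. C < K ^ 2 ^ n) sequentially"
proof -
  obtain m where m: "C < K ^ m" using real_arch_pow[OF assms] by blast
  have "C < K ^ 2 ^ n" if "n \<ge> m" for n
  proof -
    have "m \<le> 2 ^ n" using that less_exp[of n] by linarith
    then show ?thesis using m power_increasing[of m "2 ^ n" K] assms by linarith
  qed
  then show ?thesis unfolding eventually_sequentially by blast
qed

lemma eventually_double_power_dominates:
  fixes J K :: real
  assumes "0 \<le> J" "J < K" "1 < K"
  shows "eventually (\<lambda>n. 2 * (J ^ 2 ^ n + 1) < K ^ 2 ^ n) sequentially"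
proof -
  \<comment> \<open>The maximum with 1 absorbs the summand 1: \<open>2 * (J ^ 2 ^ n + 1)\<close> is
    at most \<open>4 * J' ^ 2 ^ n\<close>, which is where the constant 4 comes from.\<close>
  define J' where "J' = max 1 J"
  have J': "1 \<le> J'" "J' < K" using assms by (auto simp: J'_def)
  have "1 < K / J'" using J' by simp
  from eventually_less_double_power[OF this, of 4] show ?thesis
  proof eventually_elim
    case (elim n)
    have "J ^ 2 ^ n \<le> J' ^ 2 ^ n" using assms by (intro power_mono) (auto simp: J'_def)
    moreover have "1 \<le> J' ^ 2 ^ n" using J' by simp
    moreover have "4 * J' ^ 2 ^ n < K ^ 2 ^ n"
      using elim J' by (simp add: power_divide field_simps)
    ultimately show ?case by (smt (verit))
  qed
qed

text \<open>With \<open>B = K ^ 2 ^ k\<close>, repeated squaring outgrows doubling: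
  \<open>c (k + j) \<ge> B ^ 2 ^ j \<ge> B * 2 ^ j\<close>. A geometric series of ratio 1/2
  therefore dominates the tail.\<close>

lemma tail_le_of_double_power_growth:
  fixes c :: "nat \<Rightarrow> real"
  assumes s: "(\<lambda>j. 1 / c (k + j)) sums s"
    and c: "\<And>i. i \<ge> k \<Longrightarrow> K ^ 2 ^ i \<le> c i" and K: "2 \<le> K ^ 2 ^ k"
  shows "s \<le> 2 / K ^ 2 ^ k"
proof -
  define B where "B = K ^ 2 ^ k"
  have B: "2 \<le> B" using K by (simp add: B_def)
  have le: "1 / c (k + j) \<le> 1 / B * (1 / 2) ^ j" for j
  proof -
    have "B * 2 ^ j \<le> B * B ^ j" using B by (intro mult_left_mono power_mono) auto
    also have "\<dots> = B ^ (Suc j)" by simp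
    also have "\<dots> \<le> B ^ 2 ^ j" using B by (intro power_increasing Suc_leI less_exp) auto
    also have "\<dots> = K ^ 2 ^ (k + j)" by (simp add: B_def power_add power_mult)
    also have "\<dots> \<le> c (k + j)" using c by simp
    finally have "1 / c (k + j) \<le> 1 / (B * 2 ^ j)" using B by (intro frac_le) auto
    then show ?thesis by (simp add: power_divide)
  qed
  have "(\<lambda>j. 1 / B * (1 / 2) ^ j) sums (1 / B * (1 / (1 - 1 / 2)))"
    by (intro sums_mult geometric_sums) auto
  from sums_le[OF le s this] show ?thesis by (simp add: B_def)
qed

text \<open>For fixed \<open>q\<close> and \<open>P\<close>, \<open>q / g + g / P\<close> is convex in \<open>g = sqrt (P * p')\<close> and equals
  \<open>q / P + 1\<close> at both ends of \<open>P \<le> g \<le> q\<close>.\<close>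

lemma normalized_residual_step:
  fixes P p p' q :: real
  assumes P: "0 < P" and "P \<le> p" "P \<le> p'" and "0 < q" and le: "P * p' \<le> q\<^sup>2"
  defines "x \<equiv> q / sqrt (P * p)"
  shows "q * ((q + p') / p) / sqrt (P * p') \<le> x * (x + 1)"
proof -
  define g where "g = sqrt (P * p')"
  have pos: "0 < p" "0 < p'" using assms by auto
  have "P\<^sup>2 \<le> P * p'" using assms by (simp add: power2_eq_square)
  then have g1: "P \<le> g" unfolding g_def by (rule real_le_rsqrt)
  have g2: "g \<le> q" unfolding g_def using le \<open>0 < q\<close> by (intro real_le_lsqrt) auto
  have g: "0 < g" using g1 P by simp
  have gg: "p' = g\<^sup>2 / P" using P pos by (simp add: g_def)
  have "0 \<le> (g - P) * (q - g) / (g * P)" using g1 g2 g P by simp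
  also have "\<dots> = q / P + 1 - (q + p') / g"
    using g P by (simp add: gg field_simps power2_eq_square)
  finally have *: "(q + p') / g \<le> q / P + 1" by simp
  \<comment> \<open>The quadratic term below is exactly \<open>x\<^sup>2\<close>; only the linear
    term \<open>q / p\<close> is enlarged to \<open>x\<close>, which uses
    \<open>P \<le> p\<close>.\<close>
  have "P * p \<le> p\<^sup>2" using assms pos by (simp add: power2_eq_square)
  then have s: "sqrt (P * p) \<le> p" using pos by (intro real_le_lsqrt) auto
  have spos: "0 < sqrt (P * p)" using P pos by simp
  have "q * ((q + p') / p) / g = q / p * ((q + p') / g)" by simp
  also have "\<dots> \<le> q / p * (q / P + 1)" using * pos \<open>0 < q\<close> by (intro mult_left_mono) auto
  also have "\<dots> = x\<^sup>2 + q / p" using P pos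
    by (simp add: x_def power_divide field_simps power2_eq_square)
  also have "q / p \<le> x" unfolding x_def using s spos \<open>0 < q\<close> pos by (intro divide_left_mono) auto
  finally show ?thesis by (simp add: g_def power2_eq_square algebra_simps)
qed

text \<open>In the variables \<open>X = x + 1\<close> and \<open>Y = y + 1\<close> the map sends
  \<open>X\<close> to \<open>X\<^sup>2 - X + 1\<close>, which is increasing on the range at hand, so
  \<open>X\<close> may be replaced by \<open>d * Y\<close>. The remaining comparison is equivalent
  to \<open>0 \<le> (1 - d) * (d * Y - 1 - d)\<close>, and
  \<open>d * Y \<ge> X \<ge> 2 \<ge> 1 + d\<close>.\<close>

lemma sylvester_ratio_step:
  fixes x y d :: real
  assumes "1 \<le> x" "1 \<le> y" and le: "x + 1 \<le> d * (y + 1)" "d \<le> 1"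
  shows "x * (x + 1) + 1 \<le> d\<^sup>2 * (y * (y + 1) + 1)"
proof -
  define X Y where "X = x + 1" and "Y = y + 1"
  have X: "2 \<le> X" "2 \<le> Y" using assms by (auto simp: X_def Y_def)
  have XY: "X \<le> d * Y" using le by (simp add: X_def Y_def)
  have dY: "d * Y \<le> Y" using le(2) X by simp
  have "x * (x + 1) + 1 = X\<^sup>2 - X + 1" by (simp add: X_def power2_eq_square algebra_simps)
  also have "\<dots> \<le> (d * Y)\<^sup>2 - d * Y + 1"
  proof -
    have "0 \<le> (d * Y - X) * (d * Y + X - 1)" using XY X by (intro mult_nonneg_nonneg) auto
    then show ?thesis by (simp add: power2_eq_square algebra_simps)
  qed
  also have "\<dots> \<le> d\<^sup>2 * (Y\<^sup>2 - Y + 1)"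
  proof -
    have "1 + d \<le> d * Y"
      using XY X le(2) by simp
    then have "0 \<le> (1 - d) * (d * Y - 1 - d)" using le(2) by simp
    then show ?thesis by (simp add: power2_eq_square algebra_simps)
  qed
  also have "\<dots> = d\<^sup>2 * (y * (y + 1) + 1)" by (simp add: Y_def power2_eq_square algebra_simps)
  finally show ?thesis .
qed

text \<open>By \<open>sylvester_ratio_step\<close> the bound on \<open>(x n + 1) / (y n + 1)\<close>
  is squared at each step. A deficit at the single index \<open>m\<close> thus lowers the base of
  the doubly exponential growth by a fixed factor \<open>d\<close>.\<close>

lemma sylvester_growth_gap:
  fixes x y :: "nat \<Rightarrow> real"
  assumes "\<And>n. n \<ge> m \<Longrightarrow> 1 \<le> x n" "\<And>n. n \<ge> m \<Longrightarrow> 1 \<le> y n"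
    and x: "\<And>n. n \<ge> m \<Longrightarrow> x (Suc n) \<le> x n * (x n + 1)"
    and y: "\<And>n. n \<ge> m \<Longrightarrow> y (Suc n) = y n * (y n + 1)"
    and "x m < y m"
  obtains d where "0 < d" "d < 1" "\<And>n. n \<ge> m \<Longrightarrow> x n + 1 \<le> d ^ 2 ^ Suc n * (y n + 1)"
proof -
  define D where "D = (x m + 1) / (y m + 1)"
  have pos: "1 \<le> x m" "1 \<le> y m" using assms by auto
  have D: "0 < D" "D < 1" using pos \<open>x m < y m\<close> by (auto simp: D_def)
  \<comment> \<open>Normalised so that \<open>d ^ 2 ^ Suc m = D\<close>. The exponent carries
    \<open>Suc\<close> because \<open>y n + 1\<close> plays the role of the term
    \<open>b (Suc n)\<close>.\<close>
  define d where "d = D powr (1 / 2 ^ Suc m)"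
  have d: "0 < d" using D by (simp add: d_def)
  have d1: "d < 1"
    unfolding d_def using less_powr_half_power_iff(2)[of 1 D "Suc m"] D by simp
  have "d ^ 2 ^ Suc m = d powr (2 ^ Suc m)" using powr_realpow[OF d, of "2 ^ Suc m"] by simp
  also have "\<dots> = D" using D by (simp add: d_def powr_powr)
  finally have dD: "d ^ 2 ^ Suc m = D" .
  have "x n + 1 \<le> d ^ 2 ^ Suc n * (y n + 1)" if "n \<ge> m" for n using that
  proof (induction n rule: dec_induct)
    case base
    show ?case unfolding dD using pos by (simp add: D_def)
  next
    case (step n)
    have "d ^ 2 ^ Suc n \<le> 1" using d d1 by (intro power_le_one) auto
    then have "x n * (x n + 1) + 1 \<le> (d ^ 2 ^ Suc n)\<^sup>2 * (y n * (y n + 1) + 1)"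
      using step assms(1,2)[of n] by (intro sylvester_ratio_step) auto
    also have "(d ^ 2 ^ Suc n)\<^sup>2 = d ^ 2 ^ Suc (Suc n)"
      by (simp add: power_mult[symmetric] mult.commute)
    finally show ?case using x[of n] y[of n] step by simp
  qed
  with d d1 show ?thesis using that by blast
qed

section \<open>Structure of the eventually greedy best sequence\<close>

lemma unit_fraction_sum_map:
  "unit_fraction_sum (map f [1..<Suc n]) = (\<Sum>i=1..n. 1 / real (f i))"
  unfolding unit_fraction_sum_def
  by (simp add: comp_def interv_sum_list_conv_sum_set_nat atLeastLessThanSuc_atLeastAtMost
      del: upt_Suc)

lemma map_in_denom_tuples:
  assumes "\<And>i. 1 \<le> i \<Longrightarrow> i \<le> n \<Longrightarrow> 2 \<le> f i"
    and "\<And>i. 1 \<le> i \<Longrightarrow> i < n \<Longrightarrow> f i \<le> f (Suc i)"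
  shows "map f [1..<Suc n] \<in> denom_tuples n"
  using assms unfolding denom_tuples_def
  by (auto simp: sorted_iff_nth_Suc simp del: upt_Suc)

lemma maximizing_tuple_sum_le:
  assumes "maximizing_tuple n lam xs" "ys \<in> denom_tuples n" "unit_fraction_sum ys < lam"
  shows "unit_fraction_sum ys \<le> unit_fraction_sum xs"
  using assms by (auto simp: maximizing_tuple_def is_arg_max_linorder)

text \<open>Re-indexes the greedy tail by \<open>n\<close> itself, with \<open>y n\<close> the
  reciprocal of the residual after \<open>n\<close> terms. Admissibility of the initial segments
  needs an argument only at the passage from \<open>b N\<close> to
  \<open>b (Suc N) = T0 + 1\<close>.\<close>

lemma eventually_greedy_bestE:
  assumes "eventually_greedy_best lam b"
  obtains N y where "1 \<le> N"
    "\<And>n. n \<ge> N \<Longrightarrow> 2 \<le> y n"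
    "\<And>n. n \<ge> N \<Longrightarrow> y (Suc n) = y n * (y n + 1)"
    "\<And>n. n \<ge> N \<Longrightarrow> real (b (Suc n)) = y n + 1"
    "\<And>n. n \<ge> N \<Longrightarrow> lam - (\<Sum>i=1..n. 1 / real (b i)) = 1 / y n"
    "\<And>n. n \<ge> N \<Longrightarrow> map b [1..<Suc n] \<in> denom_tuples n"
    "\<And>n. n \<ge> N \<Longrightarrow> (\<Sum>i=1..n. 1 / real (b i)) = max_underapprox n lam"
proof -
  obtain N T0 where N: "1 \<le> N" and T0: "2 \<le> T0"
    and mx: "maximizing_tuple N lam (map b [1..<Suc N])"
    and lam: "lam = (\<Sum>i=1..N. 1 / real (b i)) + 1 / real T0"
    and b: "\<And>j. b (N + j + 1) = greedy_T T0 j + 1"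
    and mu: "\<And>n. n \<ge> N \<Longrightarrow> (\<Sum>i=1..n. 1 / real (b i)) = max_underapprox n lam"
    using assms unfolding eventually_greedy_best_def by blast
  define y where "y n = real (greedy_T T0 (n - N))" for n
  have y2: "2 \<le> y n" for n
    using greedy_T_ge[OF T0, of "n - N"] by (simp add: y_def)
  have yS: "y (Suc n) = y n * (y n + 1)" if "n \<ge> N" for n
    using that by (simp add: y_def Suc_diff_le algebra_simps)
  have bS: "b (Suc n) = greedy_T T0 (n - N) + 1" if "n \<ge> N" for n
    using b[of "n - N"] that by simp
  have res: "lam - (\<Sum>i=1..n. 1 / real (b i)) = 1 / y n" if "n \<ge> N" for n using that
  proof (induction n rule: dec_induct)
    case base
    show ?case using lam by (simp add: y_def)
  next
    case (step n)
    have "1 / y n - 1 / (y n + 1) = 1 / y (Suc n)"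
      using yS[OF step(1)] y2[of n] by (simp add: field_simps)
    moreover have "real (b (Suc n)) = y n + 1" using bS[OF step(1)] by (simp add: y_def)
    ultimately show ?case using step by simp
  qed
  have tup: "map b [1..<Suc N] \<in> denom_tuples N"
    using mx by (simp add: maximizing_tuple_def is_arg_max_def del: upt_Suc)
  then have bge: "2 \<le> b i" if "1 \<le> i" "i \<le> N" for i
    using that by (auto simp: denom_tuples_def simp del: upt_Suc)
  have bmono: "b i \<le> b (Suc i)" if "1 \<le> i" "i < N" for i
  proof -
    have "map b [1..<Suc N] ! (i - 1) \<le> map b [1..<Suc N] ! i"
      using tup that by (intro sorted_nth_mono) (auto simp: denom_tuples_def simp del: upt_Suc)
    then show ?thesis using that by (simp del: upt_Suc)
  qed
  \<comment> \<open>Otherwise replacing \<open>b N\<close> by \<open>T0 + 1\<close> would give a better \<open>N\<close>-term underapproximation.\<close>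
  have junction: "b N \<le> T0 + 1"
  proof (rule ccontr)
    assume neg: "\<not> b N \<le> T0 + 1"
    define f where "f = b(N := T0 + 1)"
    \<comment> \<open>Sorting is needed since \<open>T0 + 1\<close> may be smaller than earlier
      entries; it leaves the sum unchanged. The new sum stays below \<open>lam\<close> because
      \<open>1 / (T0 + 1) < 1 / T0\<close>.\<close>
    define ys where "ys = sort (map f [1..<Suc N])"
    have ys: "ys \<in> denom_tuples N"
      using bge T0 by (auto simp: ys_def denom_tuples_def f_def simp del: upt_Suc)
    have "mset (map (\<lambda>x. 1 / real x) ys) = mset (map (\<lambda>x. 1 / real x) (map f [1..<Suc N]))"
      by (simp only: ys_def mset_map mset_sort)
    then have "unit_fraction_sum ys = unit_fraction_sum (map f [1..<Suc N])"
      unfolding unit_fraction_sum_def by (metis sum_mset_sum_list)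
    also have "\<dots> = (\<Sum>i\<in>{1..N} - {N}. 1 / real (f i)) + 1 / real (f N)"
      unfolding unit_fraction_sum_map
      using N sum.remove[of "{1..N}" N "\<lambda>i. 1 / real (f i)"] by simp
    also have "(\<Sum>i\<in>{1..N} - {N}. 1 / real (f i)) = (\<Sum>i\<in>{1..N} - {N}. 1 / real (b i))"
      by (intro sum.cong) (auto simp: f_def)
    also have "\<dots> = (\<Sum>i=1..N. 1 / real (b i)) - 1 / real (b N)"
      using N sum.remove[of "{1..N}" N "\<lambda>i. 1 / real (b i)"] by simp
    finally have s: "unit_fraction_sum ys
        = (\<Sum>i=1..N. 1 / real (b i)) - 1 / real (b N) + 1 / real (T0 + 1)"
      by (simp add: f_def)
    have "1 / real (b N) < 1 / real (T0 + 1)"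
      using neg by (intro divide_strict_left_mono) auto
    moreover have "1 / real (T0 + 1) < 1 / real T0"
      using T0 by (intro divide_strict_left_mono) auto
    moreover have "0 \<le> 1 / real (b N)" by simp
    ultimately have "unit_fraction_sum ys < lam"
      "(\<Sum>i=1..N. 1 / real (b i)) < unit_fraction_sum ys"
      using s lam by linarith+
    then show False
      using maximizing_tuple_sum_le[OF mx ys] unfolding unit_fraction_sum_map by linarith
  qed
  have tuples: "map b [1..<Suc n] \<in> denom_tuples n" for n
  proof (rule map_in_denom_tuples)
    fix i :: nat assume i: "1 \<le> i"
    show "2 \<le> b i"
    proof (cases "i \<le> N")
      case False
      then have "b i = greedy_T T0 (i - 1 - N) + 1" using bS[of "i - 1"] by simp
      then show ?thesis using greedy_T_ge[OF T0, of "i - 1 - N"] by simp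
    qed (use i bge in simp)
    show "b i \<le> b (Suc i)"
    proof (cases i N rule: linorder_cases)
      case less
      then show ?thesis using i bmono by simp
    next
      case equal
      then show ?thesis using bS[of N] junction by simp
    next
      case greater
      then obtain k where k: "i = Suc k" "N \<le> k" by (cases i) auto
      then show ?thesis using bS[of k] bS[of "Suc k"] by (simp add: Suc_diff_le)
    qed
  qed
  have "real (b (Suc n)) = y n + 1" if "n \<ge> N" for n
    using bS[OF that] by (simp add: y_def)
  then show ?thesis
    by (rule that[of N y, rotated 3]) (blast intro: N y2 yS res tuples mu)+
qed

section \<open>Contradiction from growth and integrality\<close>

lemma tail_minimum:
  fixes p :: "nat \<Rightarrow> nat"
  obtains m where "M \<le> m" "\<And>k. k \<ge> m \<Longrightarrow> p m \<le> p k"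
  using ex_has_least_nat[of "\<lambda>k. M \<le> k" M p] by (metis order_refl order_trans)

text \<open>The core of the argument, with the greedy sequence entering through its reciprocal
  residuals \<open>y\<close>. The growth assumptions say that \<open>b\<close> grows at rate at most
  \<open>L\<close> and \<open>a\<close> at rate at least \<open>L\<close>; rationality of
  \<open>lam\<close> supplies integer numerators for the residuals of \<open>a\<close>.\<close>

lemma no_sequence_above_greedy_growth:
  fixes a :: "nat \<Rightarrow> nat" and y :: "nat \<Rightarrow> real"
  assumes lam: "lam > 0" "lam \<in> \<rat>"
    and a: "\<And>n. 1 \<le> n \<Longrightarrow> 0 < a n"
    and sums: "(\<lambda>n. 1 / real (a (Suc n))) sums lam"
    and y: "\<And>n. n \<ge> N \<Longrightarrow> 2 \<le> y n" "\<And>n. n \<ge> N \<Longrightarrow> y (Suc n) = y n * (y n + 1)"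
    and gap: "\<And>n. n \<ge> N \<Longrightarrow> 1 / y n < lam - (\<Sum>i=1..n. 1 / real (a i))"
    and L: "1 < L"
    and y_growth: "\<And>K. L < K \<Longrightarrow> eventually (\<lambda>n. y n + 1 < K ^ 2 ^ Suc n) sequentially"
    and a_growth: "\<And>K. 1 < K \<Longrightarrow> K < L \<Longrightarrow> eventually (\<lambda>n. K ^ 2 ^ n < real (a n)) sequentially"
  shows False
proof -
  define r where "r n = lam - (\<Sum>i=1..n. 1 / real (a i))" for n
  define w where "w n = 1 / r n" for n
  have r_sums: "(\<lambda>j. 1 / real (a (Suc n + j))) sums r n" for n
  proof -
    have "(\<Sum>i<n. 1 / real (a (Suc i))) = (\<Sum>i=1..n. 1 / real (a i))"
      by (rule sum.reindex_bij_witness[of _ "\<lambda>i. i - 1" Suc]) auto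
    then show ?thesis using sums_iff_shift'[of "\<lambda>n. 1 / real (a (Suc n))" n lam] sums
      by (simp add: r_def add.commute)
  qed
  have rS: "r (Suc n) = r n - 1 / real (a (Suc n))" for n by (simp add: r_def)
  have r_pos: "0 < r n" for n
  proof -
    have "0 < (\<Sum>j. 1 / real (a (Suc n + j)))"
      using r_sums[of n] a by (intro suminf_pos) (auto simp: sums_iff)
    then show ?thesis using r_sums[of n] by (simp add: sums_iff)
  qed
  have w_pos: "0 < w n" for n using r_pos by (simp add: w_def)
  have w_less: "w n < y n" if "n \<ge> N" for n
    using gap[OF that] y(1)[OF that] r_pos[of n] unfolding w_def r_def[symmetric]
    by (simp add: field_simps)
  \<comment> \<open>The exponent is \<open>2 ^ Suc n\<close> because the tail \<open>r n\<close>
    starts with \<open>a (Suc n)\<close>; the factor 2 comes from the geometric bound on that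
    tail.\<close>
  have w_growth: "eventually (\<lambda>n. K ^ 2 ^ Suc n \<le> 2 * w n) sequentially" if K: "1 < K" "K < L" for K
  proof -
    obtain n0 where n0: "\<And>n. n \<ge> n0 \<Longrightarrow> K ^ 2 ^ n < real (a n)"
      using a_growth[OF K] unfolding eventually_sequentially by blast
    obtain n1 where n1: "\<And>n. n \<ge> n1 \<Longrightarrow> 2 < K ^ 2 ^ n"
      using eventually_less_double_power[OF K(1), of 2] unfolding eventually_sequentially by blast
    have "K ^ 2 ^ Suc n \<le> 2 * w n" if "n \<ge> max n0 n1" for n
    proof -
      have "r n \<le> 2 / K ^ 2 ^ Suc n"
      proof (rule tail_le_of_double_power_growth[OF r_sums])
        show "K ^ 2 ^ i \<le> real (a i)" if "i \<ge> Suc n" for i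
          using n0[of i] that \<open>n \<ge> max n0 n1\<close> by simp
        show "2 \<le> K ^ 2 ^ Suc n" using n1[of "Suc n"] \<open>n \<ge> max n0 n1\<close> by simp
      qed
      then show ?thesis using r_pos[of n] K by (simp add: w_def field_simps)
    qed
    then show ?thesis unfolding eventually_sequentially by blast
  qed

  \<comment> \<open>The common denominator \<open>q n\<close> is deliberately not reduced, so that
    \<open>q\<close> and the numerators \<open>q n * r n\<close> obey exact recurrences with integer
    coefficients.\<close>
  obtain p0 q0 :: nat where q0: "q0 \<noteq> 0" and pq0: "lam = real p0 / real q0"
    using Rats_abs_nat_div_natE[OF lam(2)] lam(1) by (metis abs_of_pos)
  define q where "q n = real q0 * (\<Prod>i=1..n. real (a i))" for n
  have q_pos: "0 < q n" for n
    using q0 a unfolding q_def by (auto intro!: mult_pos_pos prod_pos)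
  have qS: "q (Suc n) = q n * real (a (Suc n))" for n by (simp add: q_def)
  have p_rec: "q (Suc n) * r (Suc n) = q n * r n * real (a (Suc n)) - q n" for n
    using a[of "Suc n"] by (simp add: qS rS field_simps)
  have q_int: "q n \<in> \<int>" for n
    unfolding q_def by (intro Ints_mult Ints_prod) auto
  have "q n * r n \<in> \<int>" for n
  proof (induction n)
    case 0
    show ?case using q0 by (simp add: q_def r_def pq0)
  next
    case (Suc n)
    then show ?case unfolding p_rec by (intro Ints_diff Ints_mult[OF Suc.IH] q_int) auto
  qed
  \<comment> \<open>Passing to natural numbers guarantees that a least numerator exists on every
    tail.\<close>
  then have "real (nat \<lfloor>q n * r n\<rfloor>) = q n * r n" for n
    using q_pos[of n] r_pos[of n] by (metis Ints_cases floor_of_int mult_pos_pos of_int_0_le_iff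
        of_nat_nat order_less_imp_le of_int_of_nat_eq)
  then obtain pn :: "nat \<Rightarrow> nat" where pn: "\<And>n. real (pn n) = q n * r n"
    by (rule that[of "\<lambda>n. nat \<lfloor>q n * r n\<rfloor>"])
  define p where "p n = real (pn n)" for n
  have p_pos: "0 < p n" for n using q_pos r_pos by (simp add: p_def pn)
  have wp: "w n = q n / p n" for n using q_pos[of n] r_pos[of n] by (simp add: w_def p_def pn)
  \<comment> \<open>Solving the recurrence for \<open>a (Suc n)\<close> gives
    \<open>q (Suc n) = q n * ((q n + p (Suc n)) / p n)\<close>, the shape treated by
    \<open>normalized_residual_step\<close>.\<close>
  have aS: "real (a (Suc n)) = (q n + p (Suc n)) / p n" for n
  proof -
    have "p (Suc n) = p n * real (a (Suc n)) - q n" 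
      using p_rec[of n] unfolding p_def pn .
    then show ?thesis using p_pos[of n] by (simp add: eq_divide_eq mult.commute)
  qed

  \<comment> \<open>This is what gives \<open>p m * p (Suc n) \<le> (q n)\<^sup>2\<close> below: \<open>w\<close> roughly squares at every step.\<close>
  have "eventually (\<lambda>n. w n + 1 \<le> w (Suc n) \<and> 1 \<le> w n) sequentially"
  proof -
    \<comment> \<open>\<open>K\<close> above \<open>sqrt L\<close> leaves room for \<open>J\<close>
      between \<open>L\<close> and \<open>K\<^sup>2\<close>. Then \<open>w (Suc n)\<close>, at least
      half of \<open>(K\<^sup>2) ^ 2 ^ Suc n\<close>, exceeds \<open>J ^ 2 ^ Suc n + 1\<close>,
      while \<open>w n < y n < J ^ 2 ^ Suc n\<close>.\<close>
    have "sqrt L < L" using L by (simp add: real_less_lsqrt power2_eq_square)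
    then obtain K where K: "sqrt L < K" "K < L" using dense by blast
    have "1 < sqrt L" using L by simp
    with K(1) have K1: "1 < K" by linarith
    have "(sqrt L)\<^sup>2 < K\<^sup>2" using K L by (intro power_strict_mono) auto
    then have "L < K\<^sup>2" using L by simp
    then obtain J where J: "L < J" "J < K\<^sup>2" using dense by blast
    have dom: "eventually (\<lambda>n. 2 * (J ^ 2 ^ Suc n + 1) < (K\<^sup>2) ^ 2 ^ Suc n) sequentially"
      using eventually_double_power_dominates[of J "K\<^sup>2"] J L
      by (subst eventually_sequentially_Suc) auto
    have w': "eventually (\<lambda>n. K ^ 2 ^ Suc (Suc n) \<le> 2 * w (Suc n)) sequentially"
      using w_growth[OF K1 K(2)] by (subst eventually_sequentially_Suc)
    have two: "eventually (\<lambda>n. 2 < K ^ 2 ^ Suc n) sequentially"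
      using eventually_less_double_power[OF K1, of 2] by (subst eventually_sequentially_Suc)
    show ?thesis
      using dom w' two w_growth[OF K1 K(2)] y_growth[OF J(1)] eventually_ge_at_top[of N]
    proof eventually_elim
      case (elim n)
      have "(K\<^sup>2) ^ 2 ^ Suc n = K ^ 2 ^ Suc (Suc n)" by (simp add: power_mult[symmetric])
      then show ?case using elim w_less[of n] by (smt (verit))
    qed
  qed
  then obtain M0 where M0: "\<And>n. n \<ge> M0 \<Longrightarrow> w n + 1 \<le> w (Suc n) \<and> 1 \<le> w n"
    unfolding eventually_sequentially by blast
  obtain m where m: "max M0 N \<le> m" and "\<And>k. k \<ge> m \<Longrightarrow> pn m \<le> pn k"
    using tail_minimum by blast
  then have p_min: "p m \<le> p k" if "k \<ge> m" for k using that by (simp add: p_def)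

  \<comment> \<open>The geometric mean of \<open>p m\<close> and \<open>p n\<close> replaces the
    denominator \<open>p n\<close> of \<open>w n\<close>: at \<open>n = m\<close> nothing changes,
    and afterwards minimality of \<open>p m\<close> gives \<open>w n \<le> x n\<close>.\<close>
  define x where "x n = q n / sqrt (p m * p n)" for n
  have x_ge: "w n \<le> x n" if "n \<ge> m" for n
  proof -
    have "p m * p n \<le> (p n)\<^sup>2"
      using p_min[OF that] p_pos[of n] by (simp add: power2_eq_square)
    then have "sqrt (p m * p n) \<le> p n" using p_pos[of n] by (intro real_le_lsqrt) auto
    then show ?thesis unfolding wp x_def
      using p_pos[of n] p_pos[of m] q_pos[of n] by (intro divide_left_mono) auto
  qed
  have x_step: "x (Suc n) \<le> x n * (x n + 1)" if "n \<ge> m" for n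
  proof -
    have "w n + 1 \<le> w (Suc n)" using M0 m that by simp
    \<comment> \<open>The second summand is the increment of \<open>w\<close>; that it is at least 1
      bounds the product of consecutive numerators.\<close>
    also have "w (Suc n) = w n + (q n)\<^sup>2 / (p n * p (Suc n))"
      using p_pos[of n] p_pos[of "Suc n"]
      by (simp add: wp qS aS field_simps power2_eq_square)
    finally have "p n * p (Suc n) \<le> (q n)\<^sup>2"
      using p_pos[of n] p_pos[of "Suc n"] by (simp add: field_simps)
    moreover have "p m * p (Suc n) \<le> p n * p (Suc n)"
      using p_min[OF that] p_pos[of "Suc n"] by simp
    ultimately have "p m * p (Suc n) \<le> (q n)\<^sup>2" by linarith
    from normalized_residual_step[OF p_pos p_min[OF that] p_min q_pos this] that
    show ?thesis by (simp add: x_def qS aS)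
  qed
  have "x m < y m"
    using w_less[of m] m p_pos[of m] by (simp add: x_def wp)
  moreover have "1 \<le> x n" if "n \<ge> m" for n
    using x_ge[OF that] M0[of n] m that by simp
  moreover have "1 \<le> y n" if "n \<ge> m" for n
    using y(1)[of n] m that by simp
  moreover have "y (Suc n) = y n * (y n + 1)" if "n \<ge> m" for n
    using y(2)[of n] m that by simp
  ultimately obtain d where d: "0 < d" "d < 1"
    and xd: "\<And>n. n \<ge> m \<Longrightarrow> x n + 1 \<le> d ^ 2 ^ Suc n * (y n + 1)"
    using sylvester_growth_gap[of m x y] x_step by blast

  \<comment> \<open>\<open>K\<close> is taken between \<open>d * L\<close> and \<open>L\<close>, and
    \<open>J\<close> above \<open>L\<close> with \<open>d * J < K\<close>. Then \<open>x\<close>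
    grows at rate at most \<open>d * J\<close>, whereas \<open>w \<le> x\<close> grows at rate at
    least \<open>K\<close>.\<close>
  have "max 1 (d * L) < L" using d L by simp
  then obtain K where K: "max 1 (d * L) < K" "K < L" using dense by blast
  then have "L < K / d" using d by (simp add: field_simps)
  then obtain J where J: "L < J" "J < K / d" using dense by blast
  have dJ: "0 \<le> d * J" "d * J < K" "1 < K" using J K L d by (auto simp: field_simps)
  have "eventually (\<lambda>n. 2 * ((d * J) ^ 2 ^ Suc n + 1) < K ^ 2 ^ Suc n) sequentially"
    using eventually_double_power_dominates[OF dJ] by (subst eventually_sequentially_Suc)
  then have "eventually (\<lambda>n. False) sequentially"
    using w_growth[OF dJ(3) K(2)] y_growth[OF J(1)] eventually_ge_at_top[of m]
  proof eventually_elim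
    case (elim n)
    have "d ^ 2 ^ Suc n * (y n + 1) \<le> d ^ 2 ^ Suc n * J ^ 2 ^ Suc n"
      using elim d by (intro mult_left_mono) auto
    also have "\<dots> = (d * J) ^ 2 ^ Suc n" by (simp add: power_mult_distrib)
    finally show ?case using elim xd[of n] x_ge[of n] by (smt (verit))
  qed
  then show False by simp
qed

section \<open>Reduction of the inequality to the growth contradiction\<close>

theorem corollary3:
  fixes lam :: real and a b :: "nat \<Rightarrow> nat"
  assumes "lam > 0" and "lam \<in> \<rat>"
    and "\<forall>n\<ge>1. \<exists>!xs. maximizing_tuple n lam xs"
    and "eventually_greedy_best lam b"
    and "2 \<le> a 1" and "\<forall>n\<ge>1. a n \<le> a (Suc n)"
    and "(\<lambda>n. 1 / real (a (Suc n))) sums lam"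
    and "\<exists>n\<ge>1. a n \<noteq> b n"
  shows "liminf (\<lambda>n. ereal (real (a n) powr (1 / 2 ^ n)))
           < ereal (lim (\<lambda>n. real (b n) powr (1 / 2 ^ n)))"
proof -
  obtain N y where N: "1 \<le> N"
    and y: "\<And>n. n \<ge> N \<Longrightarrow> 2 \<le> y n" "\<And>n. n \<ge> N \<Longrightarrow> y (Suc n) = y n * (y n + 1)"
    and bS: "\<And>n. n \<ge> N \<Longrightarrow> real (b (Suc n)) = y n + 1"
    and res: "\<And>n. n \<ge> N \<Longrightarrow> lam - (\<Sum>i=1..n. 1 / real (b i)) = 1 / y n"
    and btup: "\<And>n. n \<ge> N \<Longrightarrow> map b [1..<Suc n] \<in> denom_tuples n"
    and mu: "\<And>n. n \<ge> N \<Longrightarrow> (\<Sum>i=1..n. 1 / real (b i)) = max_underapprox n lam"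
    using eventually_greedy_bestE[OF assms(4)] by blast
  obtain m where m: "1 \<le> m" "a m \<noteq> b m" using assms(8) by blast
  have a2: "2 \<le> a n" if "1 \<le> n" for n using that
    by (induction n rule: dec_induct) (use assms(5,6) order_trans in auto)
  then have a_pos: "0 < a n" if "1 \<le> n" for n using that by fastforce
  \<comment> \<open>From \<open>m\<close> on the initial segments of \<open>a\<close> and
    \<open>b\<close> differ. An admissible tuple with the maximal sum is itself a maximizer, so
    uniqueness makes the sum for \<open>a\<close> strictly smaller.\<close>
  have gap: "1 / y n < lam - (\<Sum>i=1..n. 1 / real (a i))" if n: "n \<ge> max N m" for n
  proof -
    obtain xs where xs: "maximizing_tuple n lam xs"
      and uniq: "\<And>zs. maximizing_tuple n lam zs \<Longrightarrow> zs = xs"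
      using assms(3) n N by (metis max.bounded_iff order_trans)
    have same: "zs = xs" if "zs \<in> denom_tuples n" "unit_fraction_sum zs = unit_fraction_sum xs" for zs
      using that xs by (intro uniq) (simp add: maximizing_tuple_def is_arg_max_linorder)
    have sb: "unit_fraction_sum (map b [1..<Suc n]) = unit_fraction_sum xs"
      unfolding unit_fraction_sum_map using mu[of n] n max_underapprox_eq[OF xs] by simp
    then have bxs: "map b [1..<Suc n] = xs" using same btup n by simp
    have atup: "map a [1..<Suc n] \<in> denom_tuples n"
      using a2 assms(6) by (intro map_in_denom_tuples) auto
    have "(\<Sum>i=1..n. 1 / real (a i)) = (\<Sum>i<n. 1 / real (a (Suc i)))"
      by (rule sum.reindex_bij_witness[of _ Suc "\<lambda>i. i - 1"]) auto
    also have "\<dots> < (\<Sum>i. 1 / real (a (Suc i)))"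
      using a_pos assms(7) by (intro sum_less_suminf) (auto simp: sums_iff)
    finally have "unit_fraction_sum (map a [1..<Suc n]) < lam"
      unfolding unit_fraction_sum_map using assms(7) by (simp add: sums_iff)
    then have "unit_fraction_sum (map a [1..<Suc n]) \<le> unit_fraction_sum xs"
      by (rule maximizing_tuple_sum_le[OF xs atup])
    moreover have "unit_fraction_sum (map a [1..<Suc n]) \<noteq> unit_fraction_sum xs"
    proof
      assume "unit_fraction_sum (map a [1..<Suc n]) = unit_fraction_sum xs"
      then have "map a [1..<Suc n] = map b [1..<Suc n]" using same[OF atup] bxs by simp
      then have "a m = b m" using m n by (auto simp: map_eq_conv simp del: upt_Suc)
      then show False using m by simp
    qed
    ultimately show ?thesis
      using sb res[of n] n unfolding unit_fraction_sum_map by simp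
  qed
  obtain L where L: "(\<lambda>n. real (b n) powr (1 / 2 ^ n)) \<longlonglongrightarrow> L"
    using eventually_greedy_best_convergent[OF assms(4)] by blast
  \<comment> \<open>\<open>y\<close> is at least 2 at \<open>N\<close> and at least squares at each
    step. This forces \<open>L \<ge> 2 powr (1 / 2 ^ Suc N)\<close>, hence
    \<open>L > 1\<close>.\<close>
  have "2 ^ 2 ^ (n - N) \<le> y n" if "n \<ge> N" for n using that
  proof (induction n rule: dec_induct)
    case base
    show ?case using y by simp
  next
    case (step n)
    have "2 ^ 2 ^ (Suc n - N) = (2 ^ 2 ^ (n - N)) * (2 ^ 2 ^ (n - N) :: real)"
      using step by (simp add: Suc_diff_le flip: power_add mult_2)
    also have "\<dots> \<le> y n * (y n + 1)" using step y(1)[of n] by (intro mult_mono) auto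
    finally show ?case using y(2) step by simp
  qed
  then have low: "((2::real) powr (1 / 2 ^ Suc N)) ^ 2 ^ Suc n < real (b (Suc n))" if "n \<ge> N" for n
  proof -
    have "((2::real) powr (1 / 2 ^ Suc N)) ^ 2 ^ Suc n = 2 powr (2 ^ Suc n / 2 ^ Suc N)"
      by (simp add: powr_realpow[symmetric] powr_powr)
    also have "\<dots> = 2 powr (2 ^ (n - N))"
      using that by (simp add: power_diff)
    also have "\<dots> = 2 ^ 2 ^ (n - N)" using powr_realpow[of 2 "2 ^ (n - N)"] by simp
    finally show ?thesis using bS[OF that] \<open>n \<ge> N \<Longrightarrow> 2 ^ 2 ^ (n - N) \<le> y n\<close> that by simp
  qed
  have "(2::real) powr (1 / 2 ^ Suc N) \<le> real (b n) powr (1 / 2 ^ n)" if n: "n \<ge> Suc N" for n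
  proof -
    obtain k where k: "n = Suc k" "k \<ge> N" using n by (cases n) auto
    then show ?thesis
      using less_powr_half_power_iff(1)[of "(2::real) powr (1 / 2 ^ Suc N)" "real (b n)" n] low[of k]
        bS[of k] y(1)[of k] by simp
  qed
  then have "(2::real) powr (1 / 2 ^ Suc N) \<le> L"
    using LIMSEQ_le_const[OF L] by blast
  moreover have "1 < 2 powr (1 / 2 ^ Suc N :: real)" by simp
  ultimately have L1: "1 < L" by linarith
  have y_growth: "eventually (\<lambda>n. y n + 1 < K ^ 2 ^ Suc n) sequentially" if "L < K" for K
  proof -
    have "eventually (\<lambda>n. real (b (Suc n)) powr (1 / 2 ^ Suc n) < K) sequentially"
      using order_tendstoD(2)[OF L that] by (subst eventually_sequentially_Suc)
    then show ?thesis using eventually_ge_at_top[of N]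
    proof eventually_elim
      case (elim n)
      then show ?case
        using less_powr_half_power_iff(2)[of K "real (b (Suc n))" "Suc n"] bS[of n] y(1)[of n]
          that L1 by simp
    qed
  qed
  show ?thesis
  proof (rule ccontr)
    assume "\<not> ?thesis"
    \<comment> \<open>A liminf of at least \<open>L\<close> means that the roots of \<open>a\<close>
      eventually exceed every \<open>K < L\<close>.\<close>
    then have "ereal L \<le> liminf (\<lambda>n. ereal (real (a n) powr (1 / 2 ^ n)))"
      using limI[OF L] by simp
    then have ev: "eventually (\<lambda>n. ereal K < ereal (real (a n) powr (1 / 2 ^ n))) sequentially"
      if "K < L" for K
      using that unfolding le_Liminf_iff by (metis less_ereal.simps(1))
    have "eventually (\<lambda>n. K ^ 2 ^ n < real (a n)) sequentially" if "1 < K" "K < L" for K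
      using ev[OF that(2)] eventually_ge_at_top[of 1]
    proof eventually_elim
      case (elim n)
      then show ?case
        using less_powr_half_power_iff(1)[of K "real (a n)" n] a2[of n] that by simp
    qed
    then show False
      using no_sequence_above_greedy_growth[OF assms(1,2) a_pos assms(7), of "max N m" y L]
        y gap L1 y_growth by simp
  qed
qed

end
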